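(* Let $\nu>-1$, $t>0$, $0<\lambda<1$, and let $q_n^\nu,h_n^\nu$ be the three-term recurrence coefficients of the orthonormal polynomials $Q_n^\nu(x;t,\lambda)$ with respect to the weight $\rho_{k+\nu+1}(\lambda t)\lambda^k/k!$, $k\in\mathbb{N}_0$. Then they satisfy the Toda-type system $$t\frac{\partial h_n^\nu}{\partial t}-\lambda\frac{\partial h_n^\nu}{\partial\lambda}+[q_{n+1}^\nu]^2-[q_n^\nu]^2=0\quad(n\ge0),$$ $$t\frac{\partial[q_n^\nu]^2}{\partial t}-\lambda\frac{\partial[q_n^\nu]^2}{\partial\lambda}=[q_n^\nu]^2\left[h_{n-1}^\nu-h_n^\nu\right]\quad(n\ge1).$$
   Context: For $t>0$ and real $\mu$, $\rho_\mu(t)=2t^{\mu/2}K_\mu(2\sqrt t)$, where $K_\mu$ is the modified Bessel (Macdonald) function; for $\mu>0$, $\rho_\mu(t)=\int_0^\infty e^{-t/x-x}x^{\mu-1}dx$. The polynomials $Q_n^\nu(x;t,\lambda)=\alpha_n^\nu x^n+\beta_n^\nu x^{n-1}+\dots$ have real coefficients depending on $t,\lambda$, $\deg Q_n^\nu=n$, and satisfy $\sum_{k=0}^\infty Q_n^\nu(k;t,\lambda)Q_m^\nu(k;t,\lambda)\rho_{k+\nu+1}(\lambda t)\frac{\lambda^k}{k!}=\delta_{n,m}$ for all $n,m\in\mathbb{N}_0$. They satisfy $xQ_n^\nu=q_{n+1}^\nu Q_{n+1}^\nu+h_n^\nu Q_n^\nu+q_n^\nu Q_{n-1}^\nu$ with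 $q_n^\nu=\alpha_{n-1}^\nu/\alpha_n^\nu$, $h_n^\nu=\beta_n^\nu/\alpha_n^\nu-\beta_{n+1}^\nu/\alpha_{n+1}^\nu$; conventions: $Q_{-1}^\nu\equiv0$, $q_0^\nu=0$, $\beta_0^\nu=0$. Standing assumption: the coefficients of the $Q_n^\nu$ are $C^1$ functions of $(t,\lambda)$ for $t>0$, $0<\lambda<1$. *)

theory Defs
  imports "HOL-Analysis.Analysis" "HOL-Computational_Algebra.Polynomial"
begin

text \<open>
  The modified Bessel (Macdonald) function of real order \<open>\<mu>\<close> at \<open>z > 0\<close>, given by the classical
  representation \<open>K\<^sub>\<mu>(z) = \<integral>\<^sub>0\<^sup>\<infinity> exp (- z cosh u) cosh (\<mu> u) du\<close>, valid for all real \<open>\<mu>\<close>.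
\<close>
definition macdonald_K :: "real \<Rightarrow> real \<Rightarrow> real" where
  "macdonald_K \<mu> z = (LBINT u:{0..}. exp (- z * cosh u) * cosh (\<mu> * u))"

text \<open>
  For \<open>\<mu> > 0\<close> the substitution \<open>x = sqrt t * exp u\<close> turns this into
  \<open>\<integral>\<^sub>0\<^sup>\<infinity> exp (- t / x - x) x\<^sup>\<mu>\<^sup>-\<^sup>1 dx\<close>.
\<close>
definition rho :: "real \<Rightarrow> real \<Rightarrow> real" where
  "rho \<mu> t = 2 * t powr (\<mu> / 2) * macdonald_K \<mu> (2 * sqrt t)"

definition rho_weight :: "real \<Rightarrow> real \<Rightarrow> real \<Rightarrow> nat \<Rightarrow> real" where
  "rho_weight \<nu> t l k = rho (real k + \<nu> + 1) (l * t) * l ^ k / fact k"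

text \<open>Orthonormality determines each polynomial up to a sign only; no sign is prescribed.\<close>
definition orthonormal_polys :: "(nat \<Rightarrow> real) \<Rightarrow> (nat \<Rightarrow> real poly) \<Rightarrow> bool" where
  "orthonormal_polys w P \<longleftrightarrow>
     (\<forall>n. degree (P n) = n) \<and>
     (\<forall>n m. (\<lambda>k. poly (P n) (real k) * poly (P m) (real k) * w k) sums (if n = m then 1 else 0))"

definition alpha :: "(nat \<Rightarrow> real poly) \<Rightarrow> nat \<Rightarrow> real" where
  "alpha P n = coeff (P n) n"

definition beta :: "(nat \<Rightarrow> real poly) \<Rightarrow> nat \<Rightarrow> real" where
  "beta P n = (if n = 0 then 0 else coeff (P n) (n - 1))"

definition rec_q :: "(nat \<Rightarrow> real poly) \<Rightarrow> nat \<Rightarrow> real" where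
  "rec_q P n = (if n = 0 then 0 else alpha P (n - 1) / alpha P n)"

definition rec_h :: "(nat \<Rightarrow> real poly) \<Rightarrow> nat \<Rightarrow> real" where
  "rec_h P n = beta P n / alpha P n - beta P (n + 1) / alpha P (n + 1)"

text \<open>Continuous differentiability (in the Frechet sense) on an open set of the plane.\<close>
definition C1_on :: "(real \<times> real) set \<Rightarrow> (real \<times> real \<Rightarrow> real) \<Rightarrow> bool" where
  "C1_on S f \<longleftrightarrow> (\<exists>f' :: real \<times> real \<Rightarrow> (real \<times> real) \<Rightarrow>\<^sub>L real.
     (\<forall>p\<in>S. (f has_derivative blinfun_apply (f' p)) (at p)) \<and> continuous_on S f')"

lemma alpha_nonzero:
  assumes "orthonormal_polys w P"
  shows "alpha P n \<noteq> 0"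
proof
  assume a: "alpha P n = 0"
  have "degree (P n) = n" using assms by (simp add: orthonormal_polys_def)
  then have "P n = 0" using a by (metis alpha_def leading_coeff_0_iff)
  moreover have "(\<lambda>k. poly (P n) (real k) * poly (P n) (real k) * w k) sums 1"
    using assms unfolding orthonormal_polys_def by presburger
  ultimately have "(\<lambda>k::nat. 0::real) sums 1" by simp
  then show False using sums_unique2[OF sums_zero] by fastforce
qed

lemma orthonormal_expansion:
  assumes P: "orthonormal_polys w P" and "degree p \<le> m"
  shows "\<exists>c. p = (\<Sum>j\<le>m. smult (c j) (P j)) \<and> c m = coeff p m / alpha P m"
  using assms(2)
proof (induction m arbitrary: p)
  case 0
  have "degree (P 0) = 0" using P by (simp add: orthonormal_polys_def)
  then obtain a where a: "P 0 = [:a:]" by (metis degree_eq_zeroE)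
  obtain b where b: "p = [:b:]" using 0 by (metis degree_eq_zeroE le_zero_eq)
  have "a \<noteq> 0" using alpha_nonzero[OF P, of 0] by (simp add: alpha_def a)
  then show ?case
    by (intro exI[of _ "\<lambda>_. b / a"]) (simp add: a b alpha_def)
next
  case (Suc m)
  let ?c = "coeff p (Suc m) / alpha P (Suc m)"
  let ?r = "p - smult ?c (P (Suc m))"
  have d: "degree (P (Suc m)) = Suc m" using P by (simp add: orthonormal_polys_def)
  have "degree ?r \<le> m"
  proof (rule degree_le, intro allI impI)
    fix i assume i: "m < i"
    show "coeff ?r i = 0"
    proof (cases "i = Suc m")
      case True
      then show ?thesis using alpha_nonzero[OF P, of "Suc m"] by (simp add: alpha_def)
    next
      case False
      then show ?thesis using i d Suc.prems by (simp add: coeff_eq_0)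
    qed
  qed
  from Suc.IH[OF this] obtain c where c: "?r = (\<Sum>j\<le>m. smult (c j) (P j))" by blast
  have "p = (\<Sum>j\<le>m. smult (c j) (P j)) + smult ?c (P (Suc m))" using c
    by (metis diff_add_cancel)
  then have "p = (\<Sum>j\<le>Suc m. smult ((c(Suc m := ?c)) j) (P j))" by simp
  then show ?case by (intro exI[of _ "c(Suc m := ?c)"]) simp
qed

lemma orthonormal_coeff_sums:
  assumes P: "orthonormal_polys w P"
  shows "(\<lambda>k. poly (\<Sum>j\<le>m. smult (c j) (P j)) (real k) * poly (P i) (real k) * w k)
           sums (if i \<le> m then c i else 0)"
proof -
  have "(\<lambda>k. \<Sum>j\<le>m. c j * (poly (P j) (real k) * poly (P i) (real k) * w k))
          sums (\<Sum>j\<le>m. c j * (if j = i then 1 else 0))"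
    by (intro sums_sum sums_mult) (use P in \<open>auto simp: orthonormal_polys_def\<close>)
  moreover have "(\<Sum>j\<le>m. c j * (if j = i then 1 else 0)) = (if i \<le> m then c i else 0)"
    by (simp add: if_distrib cong: if_cong)
  ultimately show ?thesis
    by (simp add: poly_sum sum_distrib_right mult.assoc)
qed

text \<open>
  The coefficients \<open>rec_q\<close> and \<open>rec_h\<close> are those of the three-term recurrence.  At \<open>n = 0\<close> the last
  summand vanishes because \<open>rec_q P 0 = 0\<close>, in accordance with the convention \<open>P\<^sub>-\<^sub>1 = 0\<close>.
\<close>
lemma three_term_recurrence:
  assumes P: "orthonormal_polys w P"
  shows "[:0, 1:] * P n =
    smult (rec_q P (n + 1)) (P (n + 1)) + smult (rec_h P n) (P n) + smult (rec_q P n) (P (n - 1))"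
proof -
  define r where "r = [:0, 1:] * P n - smult (rec_q P (n + 1)) (P (n + 1))
    - smult (rec_h P n) (P n) - smult (rec_q P n) (P (n - 1))"
  have deg: "degree (P j) = j" for j using P by (simp add: orthonormal_polys_def)
  have nz: "alpha P j \<noteq> 0" for j by (rule alpha_nonzero[OF P])
  have X: "coeff ([:0, 1:] * p) i = (case i of 0 \<Rightarrow> 0 | Suc j \<Rightarrow> coeff p j)" for p :: "real poly" and i
    by (simp add: coeff_pCons split: nat.split)
  have top: "coeff r i = 0" if "i \<ge> n" for i
  proof -
    consider "i = n" | "i = Suc n" | "i > Suc n" using \<open>i \<ge> n\<close> by linarith
    then show ?thesis
    proof cases
      case 1
      show ?thesis
      proof (cases n)
        case 0
        then show ?thesis using 1 nz[of 0] nz[of 1]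
          by (simp add: r_def X rec_q_def rec_h_def alpha_def beta_def)
      next
        case (Suc m)
        have "coeff (P m) (Suc m) = 0" using deg[of m] by (simp add: coeff_eq_0)
        then show ?thesis using 1 Suc nz[of n] nz[of "Suc n"]
          by (simp add: r_def X rec_q_def rec_h_def alpha_def beta_def field_simps)
      qed
    next
      case 2
      have "coeff (P n) (Suc n) = 0" "coeff (P (n - 1)) (Suc n) = 0"
        using deg[of n] deg[of "n - 1"] by (auto intro!: coeff_eq_0)
      then show ?thesis using 2 nz[of "Suc n"]
        by (simp add: r_def X rec_q_def alpha_def)
    next
      case 3
      then obtain j where j: "i = Suc j" "j > n" by (cases i) auto
      have "coeff (P n) i = 0" "coeff (P n) j = 0" "coeff (P (n - 1)) i = 0" "coeff (P (Suc n)) i = 0"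
        using deg[of n] deg[of "n - 1"] deg[of "Suc n"] 3 j by (auto intro!: coeff_eq_0)
      then show ?thesis using j by (simp add: r_def X)
    qed
  qed
  have "r = 0"
  proof (cases n)
    case 0
    then show ?thesis using top by (intro poly_eqI) simp
  next
    case (Suc m)
    have "degree r \<le> m" using top Suc by (intro degree_le) auto
    from orthonormal_expansion[OF P this] obtain c where c: "r = (\<Sum>j\<le>m. smult (c j) (P j))"
      by blast
    have "c i = 0" if i: "i \<le> m" for i
    proof -
      have "degree ([:0, 1:] * P i) \<le> Suc i"
        using degree_mult_le[of "[:0, 1:]" "P i"] deg[of i] by simp
      from orthonormal_expansion[OF P this] obtain d
        where d: "[:0, 1:] * P i = (\<Sum>j\<le>Suc i. smult (d j) (P j))"
          "d (Suc i) = coeff ([:0, 1:] * P i) (Suc i) / alpha P (Suc i)" by blast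
      have dS: "d (Suc i) = rec_q P (Suc i)" unfolding d(2) X by (simp add: rec_q_def alpha_def)
      have s1: "(\<lambda>k. poly ([:0, 1:] * P i) (real k) * poly (P n) (real k) * w k)
          sums (if n \<le> Suc i then d n else 0)"
        unfolding d(1) by (rule orthonormal_coeff_sums[OF P])
      have s2: "(\<lambda>k. poly (P a) (real k) * poly (P i) (real k) * w k)
          sums (if a = i then 1 else 0)" for a
        using P by (simp add: orthonormal_polys_def)
      let ?L = "(if n \<le> Suc i then d n else 0) - rec_q P (n + 1) * (if n + 1 = i then 1 else 0)
          - rec_h P n * (if n = i then 1 else 0) - rec_q P n * (if n - 1 = i then 1 else 0)"
      have "(\<lambda>k. poly ([:0, 1:] * P i) (real k) * poly (P n) (real k) * w k
          - rec_q P (n + 1) * (poly (P (n + 1)) (real k) * poly (P i) (real k) * w k)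
          - rec_h P n * (poly (P n) (real k) * poly (P i) (real k) * w k)
          - rec_q P n * (poly (P (n - 1)) (real k) * poly (P i) (real k) * w k)) sums ?L"
        by (intro sums_diff sums_mult s1 s2)
      also have "(\<lambda>k. poly ([:0, 1:] * P i) (real k) * poly (P n) (real k) * w k
          - rec_q P (n + 1) * (poly (P (n + 1)) (real k) * poly (P i) (real k) * w k)
          - rec_h P n * (poly (P n) (real k) * poly (P i) (real k) * w k)
          - rec_q P n * (poly (P (n - 1)) (real k) * poly (P i) (real k) * w k)) =
          (\<lambda>k. poly r (real k) * poly (P i) (real k) * w k)"
        by (intro ext) (simp add: r_def algebra_simps)
      finally have "(\<lambda>k. poly r (real k) * poly (P i) (real k) * w k) sums ?L" .
      moreover have "(\<lambda>k. poly r (real k) * poly (P i) (real k) * w k) sums c i"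
        using orthonormal_coeff_sums[OF P, of c m i] i unfolding c by simp
      ultimately have "c i = ?L" by (rule sums_unique2[symmetric])
      also have "?L = 0" using i Suc dS by auto
      finally show ?thesis .
    qed
    then show ?thesis unfolding c by simp
  qed
  then show ?thesis by (simp add: r_def algebra_simps)
qed

end

theory Submission
  imports Defs
begin

text \<open>
  The operator \<open>t \<partial>/\<partial>t - \<lambda> \<partial>/\<partial>\<lambda>\<close> is minus the derivative, at \<open>x = 1\<close>, along the curve
  \<open>x \<mapsto> (t / x, \<lambda> x)\<close>.  The product \<open>\<lambda> t\<close>, hence the Macdonald factor of the weight, is constant on
  this curve, so the weight is there simply \<open>w\<^sub>k x\<^sup>k\<close> with a fixed sequence \<open>w\<close>
  (\<open>rho_weight_curve\<close>).  The claim is therefore the Toda equation for the deformation of an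
  arbitrary discrete weight by a factor \<open>x\<^sup>k\<close> (\<open>toda_deformation\<close>), carried back to the partial
  derivatives by the chain rule (\<open>partials_from_curve\<close>).

  For that deformation let \<open>L\<^sub>x p\<close> be the sum of \<open>p(k) w\<^sub>k x\<^sup>k\<close>.  As a power series in \<open>x\<close> it may be
  differentiated termwise, which multiplies \<open>p\<close> by the variable and divides by \<open>x\<close>
  (\<open>weighted_sum_deriv\<close>).  Differentiating \<open>L\<^sub>x (P\<^sub>n P\<^sub>m) = \<delta>\<^sub>n\<^sub>m\<close> for \<open>m \<le> n\<close> determines all
  coefficients of \<open>dP\<^sub>n/dx\<close> in the basis \<open>P\<^sub>0, \<dots>, P\<^sub>n\<close>, with the result
  (\<open>orthonormal_deriv\<close>)
    \<open>x dP\<^sub>n/dx = - (h\<^sub>n / 2) P\<^sub>n - q\<^sub>n P\<^sub>n\<^sub>-\<^sub>1\<close>.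
  Comparing the two leading coefficients gives \<open>x \<alpha>\<^sub>n' = - h\<^sub>n \<alpha>\<^sub>n / 2\<close> and
  \<open>x (\<beta>\<^sub>n / \<alpha>\<^sub>n)' = - q\<^sub>n\<^sup>2\<close>, from which both Toda equations follow by the definitions of \<open>q\<^sub>n\<close>
  and \<open>h\<^sub>n\<close> as quotients of \<open>\<alpha>\<close> and \<open>\<beta>\<close>.
\<close>

section \<open>Weighted sums of polynomials under the deformation\<close>

definition weighted_sum :: "(nat \<Rightarrow> real) \<Rightarrow> real poly \<Rightarrow> real" where
  "weighted_sum w p = (\<Sum>k. poly p (real k) * w k)"

definition coeffs_deriv :: "(real \<Rightarrow> real poly) \<Rightarrow> real poly \<Rightarrow> real \<Rightarrow> bool" where
  "coeffs_deriv p p' y \<longleftrightarrow> (\<forall>i. ((\<lambda>x. coeff (p x) i) has_real_derivative coeff p' i) (at y))"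

lemma coeffs_deriv_mult:
  assumes "coeffs_deriv p p' y" "coeffs_deriv r r' y"
  shows "coeffs_deriv (\<lambda>x. p x * r x) (p' * r y + p y * r') y"
  unfolding coeffs_deriv_def
proof
  fix i
  have "((\<lambda>x. \<Sum>j\<le>i. coeff (p x) j * coeff (r x) (i - j)) has_real_derivative
      (\<Sum>j\<le>i. coeff (p y) j * coeff r' (i - j) + coeff p' j * coeff (r y) (i - j))) (at y)"
    using assms unfolding coeffs_deriv_def by (intro DERIV_sum DERIV_mult') auto
  then show "((\<lambda>x. coeff (p x * r x) i) has_real_derivative coeff (p' * r y + p y * r') i) (at y)"
    by (simp add: coeff_mult sum.distrib add.commute)
qed

text \<open>
  Orthonormality alone yields all moments: a polynomial expands in the \<open>P\<^sub>j\<close>, and its sum against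
  the nonzero constant \<open>P\<^sub>0\<close> converges.
\<close>
lemma orthonormal_summable:
  assumes P: "orthonormal_polys w P"
  shows "summable (\<lambda>k. poly p (real k) * w k)"
proof -
  have "degree (P 0) = 0" using P by (simp add: orthonormal_polys_def)
  then obtain a where a: "P 0 = [:a:]" by (metis degree_eq_zeroE)
  have "a \<noteq> 0" using alpha_nonzero[OF P, of 0] by (simp add: alpha_def a)
  obtain c where c: "p = (\<Sum>j\<le>degree p. smult (c j) (P j))"
    using orthonormal_expansion[OF P order_refl] by blast
  have "summable (\<lambda>k. poly p (real k) * poly (P 0) (real k) * w k)"
    using orthonormal_coeff_sums[OF P, of c "degree p" 0] c by (auto intro: sums_summable)
  then have "summable (\<lambda>k. inverse a * (poly p (real k) * poly (P 0) (real k) * w k))"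
    by (rule summable_mult)
  then show ?thesis using \<open>a \<noteq> 0\<close> by (simp add: a field_simps)
qed

context
  fixes w :: "nat \<Rightarrow> real"
  assumes summ: "\<And>p. summable (\<lambda>k. poly p (real k) * w k)"
begin

lemma weighted_sum_add: "weighted_sum w (p + r) = weighted_sum w p + weighted_sum w r"
  using suminf_add[OF summ summ, of p r] by (simp add: weighted_sum_def algebra_simps)

lemma weighted_sum_smult: "weighted_sum w (smult c p) = c * weighted_sum w p"
  using suminf_mult[OF summ, of c p] by (simp add: weighted_sum_def mult.assoc)

lemma weighted_sum_sum: "finite A \<Longrightarrow> weighted_sum w (\<Sum>j\<in>A. f j) = (\<Sum>j\<in>A. weighted_sum w (f j))"
proof (induction rule: finite_induct)
  case empty
  show ?case by (simp add: weighted_sum_def)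
qed (simp add: weighted_sum_add)

lemma weighted_sum_as_moments:
  assumes "degree p \<le> N"
  shows "weighted_sum w p = (\<Sum>i\<le>N. coeff p i * weighted_sum w (monom 1 i))"
proof -
  have "p = (\<Sum>i\<le>N. smult (coeff p i) (monom 1 i))"
    using poly_as_sum_of_monoms'[OF assms] by (simp add: smult_monom)
  then show ?thesis
    by (metis (mono_tags, lifting) finite_atMost sum.cong weighted_sum_smult weighted_sum_sum)
qed

end

lemma weighted_sum_deriv_fixed:
  assumes X: "open X" "y \<in> X" "y > 0"
    and summ: "\<And>x p. x \<in> X \<Longrightarrow> summable (\<lambda>k. poly p (real k) * (w k * x ^ k))"
  shows "((\<lambda>x. weighted_sum (\<lambda>k. w k * x ^ k) p) has_real_derivative
           weighted_sum (\<lambda>k. w k * y ^ k) ([:0, 1:] * p) / y) (at y)"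
proof -
  define c where "c k = poly p (real k) * w k" for k
  obtain e where e: "e > 0" "ball y e \<subseteq> X" using X openE by blast
  define K where "K = y + e / 2"
  \<comment> \<open>Since \<open>X\<close> is open it contains a point beyond \<open>y\<close>, so \<open>y\<close> lies strictly inside the disc of
     convergence.\<close>
  have K: "K \<in> X" "y < K" using e X by (auto simp: K_def dist_real_def subset_iff)
  have sK: "summable (\<lambda>k. c k * K ^ k)" using summ[OF K(1), of p] by (simp add: c_def mult.assoc)
  have D: "((\<lambda>x. \<Sum>k. c k * x ^ k) has_real_derivative (\<Sum>k. diffs c k * y ^ k)) (at y)"
    using termdiffs_strong[OF sK] K X by simp
  have "summable (\<lambda>k. diffs c k * y ^ k)"
    by (rule termdiff_converges[of _ K]) (use K X powser_inside[OF sK] in auto)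
  from sums_mult[OF diffs_equiv[OF this], of y]
  have "(\<lambda>k. poly ([:0, 1:] * p) (real k) * (w k * y ^ k)) sums (y * (\<Sum>k. diffs c k * y ^ k))"
  proof (rule back_subst[where P = "\<lambda>f. f sums _"])
    show "(\<lambda>k. y * (of_nat k * c k * y ^ (k - Suc 0))) =
        (\<lambda>k. poly ([:0, 1:] * p) (real k) * (w k * y ^ k))"
    proof
      fix k show "y * (of_nat k * c k * y ^ (k - Suc 0)) =
          poly ([:0, 1:] * p) (real k) * (w k * y ^ k)"
        by (cases k) (simp_all add: c_def)
    qed
  qed
  then have "weighted_sum (\<lambda>k. w k * y ^ k) ([:0, 1:] * p) / y = (\<Sum>k. diffs c k * y ^ k)"
    using X by (simp add: weighted_sum_def sums_iff)
  then show ?thesis using D by (simp add: weighted_sum_def c_def mult.assoc)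
qed

text \<open>
  The uniform degree bound turns the sum into a finite combination of moments, with coefficients
  and moments both varying: the first summand comes from the former, the second from the latter.
\<close>
lemma weighted_sum_deriv:
  assumes X: "open X" "y \<in> X" "y > 0"
    and summ: "\<And>x p. x \<in> X \<Longrightarrow> summable (\<lambda>k. poly p (real k) * (w k * x ^ k))"
    and deg: "\<And>x. x \<in> X \<Longrightarrow> degree (p x) \<le> N" and deg': "degree p' \<le> N"
    and p': "coeffs_deriv p p' y"
  shows "((\<lambda>x. weighted_sum (\<lambda>k. w k * x ^ k) (p x)) has_real_derivative
           weighted_sum (\<lambda>k. w k * y ^ k) p'
           + weighted_sum (\<lambda>k. w k * y ^ k) ([:0, 1:] * p y) / y) (at y)"
proof -
  let ?L = "\<lambda>x. weighted_sum (\<lambda>k. w k * x ^ k)"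
  let ?m = "\<lambda>i. monom 1 i :: real poly"
  note sy = summ[OF X(2)]
  have "((\<lambda>x. \<Sum>i\<le>N. coeff (p x) i * ?L x (?m i)) has_real_derivative
      (\<Sum>i\<le>N. coeff p' i * ?L y (?m i) + (?L y ([:0, 1:] * ?m i) / y) * coeff (p y) i)) (at y)"
    using p' by (intro DERIV_sum DERIV_mult weighted_sum_deriv_fixed[OF X summ])
      (auto simp: coeffs_deriv_def)
  also have "(\<Sum>i\<le>N. coeff p' i * ?L y (?m i) + (?L y ([:0, 1:] * ?m i) / y) * coeff (p y) i)
      = ?L y p' + ?L y ([:0, 1:] * p y) / y"
  proof -
    have "[:0, 1:] * p y = (\<Sum>i\<le>N. smult (coeff (p y) i) ([:0, 1:] * ?m i))"
      using arg_cong[OF poly_as_sum_of_monoms'[OF deg[OF X(2)]], of "\<lambda>r. [:0, 1:] * r", symmetric]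
      by (simp add: sum_distrib_left smult_monom flip: mult_smult_right)
    then have "?L y ([:0, 1:] * p y) = (\<Sum>i\<le>N. coeff (p y) i * ?L y ([:0, 1:] * ?m i))"
      using weighted_sum_sum[OF sy] weighted_sum_smult[OF sy]
      by (metis (mono_tags, lifting) finite_atMost sum.cong)
    moreover have "?L y p' = (\<Sum>i\<le>N. coeff p' i * ?L y (?m i))"
      by (rule weighted_sum_as_moments[OF sy deg'])
    ultimately show ?thesis
      by (simp add: sum.distrib sum_divide_distrib mult.commute)
  qed
  finally have D: "((\<lambda>x. \<Sum>i\<le>N. coeff (p x) i * ?L x (?m i)) has_real_derivative
      ?L y p' + ?L y ([:0, 1:] * p y) / y) (at y)" .
  have "?L x (p x) = (\<Sum>i\<le>N. coeff (p x) i * ?L x (?m i))" if "x \<in> X" for x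
    by (rule weighted_sum_as_moments[OF summ[OF that] deg[OF that]])
  then show ?thesis
    by (intro has_field_derivative_transform_within_open[OF D X(1,2)]) auto
qed

section \<open>The Toda equations for a one-parameter deformation\<close>

lemma orthonormal_weighted_sum:
  assumes "orthonormal_polys w P"
  shows "weighted_sum w (P n * P m) = (if n = m then 1 else 0)"
  using assms by (simp add: orthonormal_polys_def weighted_sum_def sums_iff)

lemma orthonormal_low_degree:
  assumes P: "orthonormal_polys w P" and "degree p < n"
  shows "weighted_sum w (p * P n) = 0"
proof -
  obtain c where c: "p = (\<Sum>j\<le>degree p. smult (c j) (P j))"
    using orthonormal_expansion[OF P order_refl] by blast
  then show ?thesis
    using orthonormal_coeff_sums[OF P, of c "degree p" n] assms(2)
    by (simp add: weighted_sum_def sums_iff)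
qed

lemma weighted_sum_shift:
  assumes P: "orthonormal_polys w P" and "m \<le> n"
  shows "weighted_sum w ([:0, 1:] * (P n * P m)) =
    (if m = n then rec_h P n else if Suc m = n then rec_q P n else 0)"
proof -
  note s = orthonormal_summable[OF P]
  have "[:0, 1:] * (P n * P m) = smult (rec_q P (n + 1)) (P (n + 1) * P m)
      + smult (rec_h P n) (P n * P m) + smult (rec_q P n) (P (n - 1) * P m)"
    using arg_cong[OF three_term_recurrence[OF P, of n], of "\<lambda>r. r * P m"]
    by (simp add: algebra_simps del: mult_pCons_left)
  then have "weighted_sum w ([:0, 1:] * (P n * P m)) =
      rec_q P (n + 1) * (if n + 1 = m then 1 else 0)
      + rec_h P n * (if n = m then 1 else 0) + rec_q P n * (if n - 1 = m then 1 else 0)"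
    by (simp only: weighted_sum_add[OF s] weighted_sum_smult[OF s] orthonormal_weighted_sum[OF P])
  then show ?thesis using assms(2) by (auto simp: rec_q_def)
qed

text \<open>
  Differentiating \<open>L\<^sub>x (P\<^sub>n P\<^sub>m) = \<delta>\<^sub>n\<^sub>m\<close> gives
  \<open>L (P\<^sub>n' P\<^sub>m) + L (P\<^sub>n P\<^sub>m') = - L (X P\<^sub>n P\<^sub>m) / y\<close>.  For \<open>m < n\<close> the second summand vanishes because
  \<open>P\<^sub>m'\<close> has degree below \<open>n\<close>; for \<open>m = n\<close> both summands agree, whence the factor \<open>1/2\<close>.
\<close>
lemma orthonormal_deriv:
  assumes X: "open X" "y \<in> X" "y > 0"
    and P: "\<And>x. x \<in> X \<Longrightarrow> orthonormal_polys (\<lambda>k. w k * x ^ k) (P x)"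
    and P': "\<And>n. coeffs_deriv (\<lambda>x. P x n) (P' n) y"
  shows "P' n = smult (- rec_h (P y) n / (2 * y)) (P y n)
                + smult (- rec_q (P y) n / y) (P y (n - 1))"
proof -
  let ?L = "weighted_sum (\<lambda>k. w k * y ^ k)"
  have deg: "degree (P x m) = m" if "x \<in> X" for x m
    using P[OF that] by (simp add: orthonormal_polys_def)
  have deg': "degree (P' m) \<le> m" for m
  proof (rule degree_le, intro allI impI)
    fix i assume "m < i"
    then have "\<And>x. x \<in> X \<Longrightarrow> 0 = coeff (P x m) i" using deg by (simp add: coeff_eq_0)
    from has_field_derivative_transform_within_open[OF DERIV_const X(1,2) this]
    have "((\<lambda>x. coeff (P x m) i) has_real_derivative 0) (at y)" by simp
    then show "coeff (P' m) i = 0"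
      using P'[of m] DERIV_unique unfolding coeffs_deriv_def by blast
  qed
  note summ = orthonormal_summable[OF P]
  note Py = P[OF X(2)]
  note sy = summ[OF X(2)]
  have pairing: "?L (P' n * P y m) + ?L (P' m * P y n) + ?L ([:0, 1:] * (P y n * P y m)) / y = 0" for m
  proof -
    have d: "degree (P x n * P x m) \<le> n + m" if "x \<in> X" for x
      using degree_mult_le[of "P x n" "P x m"] deg[OF that] by simp
    have "degree (P' n * P y m) \<le> n + m" "degree (P y n * P' m) \<le> n + m"
      using degree_mult_le[of "P' n" "P y m"] degree_mult_le[of "P y n" "P' m"]
        deg[OF X(2)] deg'[of n] deg'[of m] by force+
    then have d': "degree (P' n * P y m + P y n * P' m) \<le> n + m" by (rule degree_add_le)
    have D: "((\<lambda>x. weighted_sum (\<lambda>k. w k * x ^ k) (P x n * P x m)) has_real_derivative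
        ?L (P' n * P y m + P y n * P' m) + ?L ([:0, 1:] * (P y n * P y m)) / y) (at y)"
      by (rule weighted_sum_deriv[OF X summ d d' coeffs_deriv_mult[OF P' P']])
    have "((\<lambda>x. weighted_sum (\<lambda>k. w k * x ^ k) (P x n * P x m)) has_real_derivative 0) (at y)"
      by (rule has_field_derivative_transform_within_open[OF DERIV_const X(1,2)])
        (rule orthonormal_weighted_sum[OF P, symmetric])
    from DERIV_unique[OF D this] show ?thesis
      by (simp add: weighted_sum_add[OF sy] mult.commute del: mult_pCons_left)
  qed
  obtain c where c: "P' n = (\<Sum>j\<le>n. smult (c j) (P y j))"
    using orthonormal_expansion[OF Py deg'] by blast
  have c_eq: "c m = ?L (P' n * P y m)" if "m \<le> n" for m
    using orthonormal_coeff_sums[OF Py, of c n m] that unfolding c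
    by (simp add: weighted_sum_def sums_iff)
  have c_val: "c m = (if m = n then - rec_h (P y) n / (2 * y)
      else if Suc m = n then - rec_q (P y) n / y else 0)" if m: "m \<le> n" for m
  proof (cases "m = n")
    case True
    then show ?thesis using pairing[of n] weighted_sum_shift[OF Py, of n n] c_eq[of n] X
      by (simp add: field_simps del: mult_pCons_left)
  next
    case False
    then have "?L (P' m * P y n) = 0"
      using orthonormal_low_degree[OF Py, of "P' m" n] deg'[of m] m by simp
    then show ?thesis using False pairing[of m] weighted_sum_shift[OF Py m] c_eq[OF m] X
      by (auto simp: field_simps simp del: mult_pCons_left)
  qed
  have "P' n = (\<Sum>j\<le>n. smult (if j = n then - rec_h (P y) n / (2 * y)
      else if Suc j = n then - rec_q (P y) n / y else 0) (P y j))"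
    unfolding c by (intro sum.cong) (auto simp: c_val)
  also have "\<dots> = smult (- rec_h (P y) n / (2 * y)) (P y n)
                + smult (- rec_q (P y) n / y) (P y (n - 1))"
  proof (cases n)
    case 0
    then show ?thesis by (simp add: rec_q_def)
  next
    case (Suc m)
    have "(\<Sum>j<m. smult (if j = n then - rec_h (P y) n / (2 * y)
      else if Suc j = n then - rec_q (P y) n / y else 0) (P y j)) = 0"
      using Suc by (intro sum.neutral) auto
    then show ?thesis using Suc by (simp add: lessThan_Suc_atMost[symmetric] del: smult_minus_left)
  qed
  finally show ?thesis .
qed

lemma toda_deformation:
  assumes X: "open X" "y \<in> X" "y > 0"
    and P: "\<And>x. x \<in> X \<Longrightarrow> orthonormal_polys (\<lambda>k. w k * x ^ k) (P x)"
    and diff: "\<And>n i. (\<lambda>x. coeff (P x n) i) field_differentiable (at y)"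
  shows "((\<lambda>x. rec_h (P x) n) has_real_derivative
           ((rec_q (P y) (n + 1))\<^sup>2 - (rec_q (P y) n)\<^sup>2) / y) (at y)"
    and "n \<ge> 1 \<Longrightarrow> ((\<lambda>x. (rec_q (P x) n)\<^sup>2) has_real_derivative
           (rec_q (P y) n)\<^sup>2 * (rec_h (P y) n - rec_h (P y) (n - 1)) / y) (at y)"
proof -
  note Py = P[OF X(2)]
  have deg: "degree (P x m) = m" if "x \<in> X" for x m
    using P[OF that] by (simp add: orthonormal_polys_def)
  define P' where "P' n = (\<Sum>i\<le>n. monom (deriv (\<lambda>x. coeff (P x n) i) y) i)" for n
  have P': "coeffs_deriv (\<lambda>x. P x m) (P' m) y" for m
    unfolding coeffs_deriv_def
  proof
    fix i
    have D: "((\<lambda>x. coeff (P x m) i) has_real_derivative deriv (\<lambda>x. coeff (P x m) i) y) (at y)"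
      using diff[of m i] by (simp add: field_differentiable_derivI)
    show "((\<lambda>x. coeff (P x m) i) has_real_derivative coeff (P' m) i) (at y)"
    proof (cases "i \<le> m")
      case True
      then show ?thesis using D by (simp add: P'_def coeff_sum)
    next
      case False
      then have "\<And>x. x \<in> X \<Longrightarrow> 0 = coeff (P x m) i" using deg by (simp add: coeff_eq_0)
      from has_field_derivative_transform_within_open[OF DERIV_const X(1,2) this]
      show ?thesis using False by (simp add: P'_def coeff_sum)
    qed
  qed
  have coeff_D: "((\<lambda>x. coeff (P x m) i) has_real_derivative
      - rec_h (P y) m / (2 * y) * coeff (P y m) i - rec_q (P y) m / y * coeff (P y (m - 1)) i) (at y)"
    for m i
  proof -
    have "P' m = smult (- rec_h (P y) m / (2 * y)) (P y m) + smult (- rec_q (P y) m / y) (P y (m - 1))"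
      by (rule orthonormal_deriv[OF X P P'])
    then have "coeff (P' m) i = - rec_h (P y) m / (2 * y) * coeff (P y m) i
        - rec_q (P y) m / y * coeff (P y (m - 1)) i" by simp
    then show ?thesis using P'[of m] unfolding coeffs_deriv_def by metis
  qed
  have nz: "alpha (P y) m \<noteq> 0" for m by (rule alpha_nonzero[OF Py])
  have alpha_D: "((\<lambda>x. alpha (P x) m) has_real_derivative
      - rec_h (P y) m / (2 * y) * alpha (P y) m) (at y)" for m
  proof (cases m)
    case 0
    then show ?thesis using coeff_D[of 0 0] by (simp add: alpha_def rec_q_def)
  next
    case (Suc j)
    then have "coeff (P y (m - 1)) m = 0" using deg[OF X(2), of j] by (simp add: coeff_eq_0)
    then show ?thesis using coeff_D[of m m] by (simp add: alpha_def)
  qed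
  have ratio_D: "((\<lambda>x. beta (P x) m / alpha (P x) m) has_real_derivative
      - (rec_q (P y) m)\<^sup>2 / y) (at y)" for m
  proof (cases m)
    case 0
    then show ?thesis by (simp add: beta_def rec_q_def)
  next
    case (Suc j)
    have "((\<lambda>x. beta (P x) m) has_real_derivative
        - rec_h (P y) m / (2 * y) * beta (P y) m - rec_q (P y) m / y * alpha (P y) (m - 1)) (at y)"
      using coeff_D[of m j] Suc by (simp add: beta_def alpha_def)
    from DERIV_divide[OF this alpha_D nz]
    show ?thesis
      by (rule DERIV_cong) (use nz X Suc in \<open>simp add: rec_q_def field_simps power2_eq_square\<close>)
  qed
  show "((\<lambda>x. rec_h (P x) n) has_real_derivative
           ((rec_q (P y) (n + 1))\<^sup>2 - (rec_q (P y) n)\<^sup>2) / y) (at y)"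
    unfolding rec_h_def
    by (rule DERIV_cong[OF DERIV_diff[OF ratio_D ratio_D]]) (simp add: diff_divide_distrib)
  assume n: "n \<ge> 1"
  have "((\<lambda>x. rec_q (P x) n) has_real_derivative
      rec_q (P y) n * (rec_h (P y) n - rec_h (P y) (n - 1)) / (2 * y)) (at y)"
    using DERIV_divide[OF alpha_D alpha_D nz, of "n - 1" n] n nz X
    by (auto simp: rec_q_def field_simps elim!: DERIV_cong)
  from DERIV_power[OF this, of 2]
  show "((\<lambda>x. (rec_q (P x) n)\<^sup>2) has_real_derivative
           (rec_q (P y) n)\<^sup>2 * (rec_h (P y) n - rec_h (P y) (n - 1)) / y) (at y)"
    by (rule DERIV_cong) (use X in \<open>simp add: power2_eq_square field_simps\<close>)
qed

section \<open>The curve of constant product\<close>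

lemma rho_weight_curve:
  assumes "x \<noteq> 0"
  shows "rho_weight \<nu> (t / x) (l * x) k = rho_weight \<nu> t l k * x ^ k"
  using assms by (simp add: rho_weight_def power_mult_distrib)

lemma curve_differentiable:
  assumes "F differentiable (at (t, l))"
  shows "(\<lambda>x. F (t / x, l * x)) field_differentiable (at (1::real))"
proof -
  have "(\<lambda>x::real. (t / x, l * x)) differentiable (at 1)"
    by (auto intro!: differentiable_Pair derivative_intros)
  then have "(F \<circ> (\<lambda>x. (t / x, l * x))) differentiable (at 1)"
    using assms by (intro differentiable_chain_at) auto
  then show ?thesis by (auto simp: o_def field_differentiable_def real_differentiable_def)
qed

text \<open>
  Joint differentiability is what allows the derivative along the curve, whose velocity at \<open>1\<close> is
  \<open>(- t, l)\<close>, to be split into the two partial derivatives.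
\<close>
lemma partials_from_curve:
  fixes F :: "real \<times> real \<Rightarrow> real"
  assumes F: "F differentiable (at (t, l))"
    and D: "((\<lambda>x. F (t / x, l * x)) has_real_derivative d) (at 1)"
  shows "(\<lambda>s. F (s, l)) field_differentiable (at t)" "(\<lambda>u. F (t, u)) field_differentiable (at l)"
    "t * deriv (\<lambda>s. F (s, l)) t - l * deriv (\<lambda>u. F (t, u)) l = - d"
proof -
  obtain F' where F': "(F has_derivative F') (at (t, l))" using F by (auto simp: differentiable_def)
  interpret bounded_linear F' using F' by (rule has_derivative_bounded_linear)
  have sc: "F' (a * c, b * c) = F' (a, b) * c" for a b c
    using scaleR[of c "(a, b)"] by (simp add: mult.commute)
  have e: "(\<lambda>r. F' (r, 0)) = (*) (F' (1, 0))" "(\<lambda>r. F' (0, r)) = (*) (F' (0, 1))"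
  proof -
    have "F' (r, 0) = F' (1, 0) * r" "F' (0, r) = F' (0, 1) * r" for r
      using sc[of 1 r 0] sc[of 0 r 1] by simp_all
    then show "(\<lambda>r. F' (r, 0)) = (*) (F' (1, 0))" "(\<lambda>r. F' (0, r)) = (*) (F' (0, 1))"
      by blast+
  qed
  have "((\<lambda>s. F (s, l)) has_derivative (\<lambda>r. F' (r, 0))) (at t)"
    by (rule has_derivative_compose[of "\<lambda>s. (s, l)", where g = F])
      (auto intro!: derivative_eq_intros simp: F')
  then have s: "((\<lambda>s. F (s, l)) has_real_derivative F' (1, 0)) (at t)"
    by (simp only: e has_field_derivative_def)
  have "((\<lambda>u. F (t, u)) has_derivative (\<lambda>r. F' (0, r))) (at l)"
    by (rule has_derivative_compose[of "\<lambda>u. (t, u)", where g = F])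
      (auto intro!: derivative_eq_intros simp: F')
  then have u: "((\<lambda>u. F (t, u)) has_real_derivative F' (0, 1)) (at l)"
    by (simp only: e has_field_derivative_def)
  have "((\<lambda>x. (t / x, l * x)) has_derivative (\<lambda>r. (- t * r, l * r))) (at (1::real))"
    by (auto intro!: derivative_eq_intros)
  then have "((\<lambda>x. F (t / x, l * x)) has_derivative (\<lambda>r. F' (- t * r, l * r))) (at 1)"
    by (rule has_derivative_compose) (simp add: F')
  then have "((\<lambda>x. F (t / x, l * x)) has_real_derivative F' (- t, l)) (at 1)"
    by (simp only: sc has_field_derivative_def)
  then have "d = F' (- t, l)" using D DERIV_unique by blast
  also have "\<dots> = - t * F' (1, 0) + l * F' (0, 1)"
    using add[of "(- t, 0)" "(0, l)"] sc[of 1 "- t" 0] sc[of 0 l 1]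
    by (simp add: mult.commute)
  finally show "t * deriv (\<lambda>s. F (s, l)) t - l * deriv (\<lambda>u. F (t, u)) l = - d"
    using DERIV_imp_deriv[OF s] DERIV_imp_deriv[OF u] by simp
  show "(\<lambda>s. F (s, l)) field_differentiable (at t)" "(\<lambda>u. F (t, u)) field_differentiable (at l)"
    using s u by (auto simp: field_differentiable_def)
qed

theorem mainTheorem7:
  fixes \<nu> t l :: real
    and Q :: "nat \<Rightarrow> real \<Rightarrow> real \<Rightarrow> real poly"
    and q h :: "nat \<Rightarrow> real \<Rightarrow> real \<Rightarrow> real"
  assumes q_def: "q = (\<lambda>n s u. rec_q (\<lambda>m. Q m s u) n)"
    and h_def: "h = (\<lambda>n s u. rec_h (\<lambda>m. Q m s u) n)"
    and nu: "\<nu> > - 1"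
    and orth: "\<And>s u. 0 < s \<Longrightarrow> 0 < u \<Longrightarrow> u < 1 \<Longrightarrow>
      orthonormal_polys (rho_weight \<nu> s u) (\<lambda>n. Q n s u)"
    and C1: "\<And>n i. C1_on ({0<..} \<times> {0<..<1}) (\<lambda>(s, u). coeff (Q n s u) i)"
    and t: "0 < t" and l: "0 < l" "l < 1"
  shows "(\<forall>n. (\<lambda>s. h n s l) field_differentiable (at t) \<and>
             (\<lambda>u. h n t u) field_differentiable (at l) \<and>
             t * deriv (\<lambda>s. h n s l) t - l * deriv (\<lambda>u. h n t u) l
               + (q (n + 1) t l)\<^sup>2 - (q n t l)\<^sup>2 = 0) \<and>
         (\<forall>n\<ge>1. (\<lambda>s. (q n s l)\<^sup>2) field_differentiable (at t) \<and>
             (\<lambda>u. (q n t u)\<^sup>2) field_differentiable (at l) \<and>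
             t * deriv (\<lambda>s. (q n s l)\<^sup>2) t - l * deriv (\<lambda>u. (q n t u)\<^sup>2) l
               = (q n t l)\<^sup>2 * (h (n - 1) t l - h n t l))"
proof -
  let ?P = "\<lambda>x n. Q n (t / x) (l * x)"
  have P: "orthonormal_polys (\<lambda>k. rho_weight \<nu> t l k * x ^ k) (?P x)" if x: "x \<in> {0<..<1 / l}" for x
  proof -
    have "x \<noteq> 0" using x by simp
    have "orthonormal_polys (rho_weight \<nu> (t / x) (l * x)) (?P x)"
      using x t l by (intro orth) (auto simp: field_simps)
    moreover have "rho_weight \<nu> (t / x) (l * x) = (\<lambda>k. rho_weight \<nu> t l k * x ^ k)"
      using rho_weight_curve[OF \<open>x \<noteq> 0\<close>] by blast
    ultimately show ?thesis by simp
  qed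
  have nz: "alpha (\<lambda>m. Q m t l) n \<noteq> 0" for n using alpha_nonzero[OF orth[OF t l]] .
  have dQ: "(\<lambda>p. coeff (Q n (fst p) (snd p)) i) differentiable (at (t, l))" for n i
  proof -
    obtain f' where f': "\<And>p. p \<in> {0<..} \<times> {0<..<1} \<Longrightarrow>
        ((\<lambda>(s, u). coeff (Q n s u) i) has_derivative blinfun_apply (f' p)) (at p)"
      using C1[of n i] unfolding C1_on_def by metis
    from f'[of "(t, l)"] show ?thesis
      using t l unfolding differentiable_def case_prod_unfold by auto
  qed
  have da: "(\<lambda>p. alpha (\<lambda>m. Q m (fst p) (snd p)) n) differentiable (at (t, l))" for n
    unfolding alpha_def by (rule dQ)
  have db: "(\<lambda>p. beta (\<lambda>m. Q m (fst p) (snd p)) n) differentiable (at (t, l))" for n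
    using dQ by (cases n) (simp_all add: beta_def)
  have dh: "(\<lambda>p. h n (fst p) (snd p)) differentiable (at (t, l))" for n
    unfolding h_def rec_h_def using nz
    by (intro differentiable_diff differentiable_divide da db) auto
  have dq: "(\<lambda>p. (q n (fst p) (snd p))\<^sup>2) differentiable (at (t, l))" for n
    unfolding q_def rec_q_def using nz
    by (cases n) (auto intro!: differentiable_power differentiable_divide da)
  have X: "open {0<..<1 / l}" "1 \<in> {0<..<1 / l}" "(1::real) > 0" using l by auto
  have dP: "(\<lambda>x. coeff (?P x n) i) field_differentiable (at 1)" for n i
    using curve_differentiable[OF dQ] by simp
  note toda = toda_deformation[OF X P dP]
  have H: "((\<lambda>x. h n (t / x) (l * x)) has_real_derivative (q (n + 1) t l)\<^sup>2 - (q n t l)\<^sup>2) (at 1)" for n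
    using toda(1)[of n] by (simp add: h_def q_def)
  have Q2: "((\<lambda>x. (q n (t / x) (l * x))\<^sup>2) has_real_derivative
      (q n t l)\<^sup>2 * (h n t l - h (n - 1) t l)) (at 1)" if "n \<ge> 1" for n
    using toda(2)[OF _ that] by (simp add: h_def q_def)
  have "t * deriv (\<lambda>s. h n s l) t - l * deriv (\<lambda>u. h n t u) l
               + (q (n + 1) t l)\<^sup>2 - (q n t l)\<^sup>2 = 0"
    "(\<lambda>s. h n s l) field_differentiable (at t)" "(\<lambda>u. h n t u) field_differentiable (at l)" for n
    using partials_from_curve[OF dh, of n "(q (n + 1) t l)\<^sup>2 - (q n t l)\<^sup>2"] H[of n] by simp_all
  moreover have "t * deriv (\<lambda>s. (q n s l)\<^sup>2) t - l * deriv (\<lambda>u. (q n t u)\<^sup>2) l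
               = (q n t l)\<^sup>2 * (h (n - 1) t l - h n t l)"
    "(\<lambda>s. (q n s l)\<^sup>2) field_differentiable (at t)" "(\<lambda>u. (q n t u)\<^sup>2) field_differentiable (at l)"
    if "n \<ge> 1" for n
    using partials_from_curve[OF dq, of n "(q n t l)\<^sup>2 * (h n t l - h (n - 1) t l)"] Q2[OF that]
    by (simp_all add: algebra_simps)
  ultimately show ?thesis by blast
qed

end
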